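(* Let $n=\prod_{i=1}^{k}p_i^{\alpha_i}$ where $p_1,\dots,p_k$ are distinct primes and $\alpha_i\ge1$. If $k\ge 3$, then the power graph $\mathfrak{g}(\mathbb{Z}_n)$ has no simplicial vertex.
   Context: The power graph $\mathfrak{g}(G)$ of a group $G$ has vertex set $G$, distinct $x,y$ adjacent iff $\langle x\rangle\le\langle y\rangle$ or $\langle y\rangle\le\langle x\rangle$. A vertex is simplicial if its neighbours are pairwise adjacent. $\mathbb{Z}_n$ is the additive group of integers mod $n$. *)

theory Defs
  imports
    "HOL-Algebra.Elementary_Groups"
    "HOL-Algebra.Generated_Groups"
    "HOL-Computational_Algebra.Primes"
    "Graph_Theory.Pair_Digraph"
begin

text \<open>
  Undirected simple graphs are represented, as usual in \<^theory>\<open>Graph_Theory.Pair_Digraph\<close>, by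
  symmetric loop-free sets of pairs; \<open>\<langle>x\<rangle>\<close> is \<open>generate G {x}\<close>.
\<close>

definition power_graph :: "('a, 'b) monoid_scheme \<Rightarrow> 'a pair_pre_digraph" where
  "power_graph G = \<lparr> pverts = carrier G,
     parcs = {(x, y). x \<in> carrier G \<and> y \<in> carrier G \<and> x \<noteq> y \<and>
       (generate G {x} \<subseteq> generate G {y} \<or> generate G {y} \<subseteq> generate G {x})} \<rparr>"

definition neighbours :: "'a pair_pre_digraph \<Rightarrow> 'a \<Rightarrow> 'a set" where
  "neighbours \<Gamma> v = {u. (v, u) \<in> parcs \<Gamma>}"

definition simplicial_vertex :: "'a pair_pre_digraph \<Rightarrow> 'a \<Rightarrow> bool" where
  "simplicial_vertex \<Gamma> v \<longleftrightarrow> v \<in> pverts \<Gamma> \<and>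
     (\<forall>u \<in> neighbours \<Gamma> v. \<forall>w \<in> neighbours \<Gamma> v. u \<noteq> w \<longrightarrow> (u, w) \<in> parcs \<Gamma>)"

lemma pair_bidirected_digraph_power_graph: "pair_bidirected_digraph (power_graph G)"
  by unfold_locales (auto simp: power_graph_def symmetric_def sym_def)

lemma pair_graph_power_graph:
  assumes "finite (carrier G)"
  shows "pair_graph (power_graph G)"
proof -
  interpret pair_bidirected_digraph "power_graph G"
    by (rule pair_bidirected_digraph_power_graph)
  have "parcs (power_graph G) \<subseteq> carrier G \<times> carrier G"
    by (auto simp: power_graph_def)
  then have "finite (parcs (power_graph G))"
    using assms by (auto intro: finite_subset)
  then show ?thesis
    using assms by unfold_locales (auto simp: power_graph_def)
qed

end

theory Submission
  imports Defs
begin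

text \<open>
  Subgroups of \<open>\<int>\<^sub>n\<close> correspond to divisors of \<open>n\<close>, \<open>\<langle>x\<rangle>\<close> being given by \<open>gcd x n\<close>, so adjacency
  in the power graph means comparability of these divisors. Let \<open>g = gcd v n\<close>, \<open>n = g d\<close>. Given three
  prime factors of \<open>n\<close>, two of them, \<open>p\<close> and \<open>q\<close>, either both divide \<open>d\<close> or both do not. In the
  first case \<open>n/p\<close> and \<open>n/q\<close>, in the second case \<open>g/p\<close> and \<open>g/q\<close> are neighbours of \<open>v\<close> that are not
  adjacent to each other.
\<close>

lemma generate_integer_mod_group:
  assumes "x \<in> carrier (integer_mod_group n)"
  shows "generate (integer_mod_group n) {x} = range (\<lambda>k. (k * x) mod int n)"
  using group.generate_pow[OF group_integer_mod_group assms]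
  by (auto simp: int_pow_integer_mod_group)

text \<open>Modulo \<open>n\<close>, the multiples of \<open>y\<close> are exactly the multiples of
  \<open>gcd y n\<close>: one inclusion is divisibility, the other is Bezout.\<close>

lemma generate_integer_mod_group_subset_iff:
  assumes "x \<in> carrier (integer_mod_group n)" "y \<in> carrier (integer_mod_group n)"
  shows "generate (integer_mod_group n) {x} \<subseteq> generate (integer_mod_group n) {y}
    \<longleftrightarrow> gcd y (int n) dvd gcd x (int n)"
proof
  assume sub: "generate (integer_mod_group n) {x} \<subseteq> generate (integer_mod_group n) {y}"
  have "x mod int n \<in> generate (integer_mod_group n) {x}"
    unfolding generate_integer_mod_group[OF assms(1)] by (rule range_eqI[of _ _ 1]) simp
  then obtain k where "x mod int n = (k * y) mod int n"
    using sub generate_integer_mod_group[OF assms(2)] by blast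
  moreover have "gcd y (int n) dvd (k * y) mod int n"
    by (intro dvd_mod) auto
  ultimately have "gcd y (int n) dvd x"
    by (metis dvd_mod_iff gcd_dvd2)
  then show "gcd y (int n) dvd gcd x (int n)"
    by simp
next
  assume "gcd y (int n) dvd gcd x (int n)"
  then obtain c where c: "x = gcd y (int n) * c"
    by (metis dvdE dvd_trans gcd_dvd1)
  \<comment> \<open>Bezout turns \<open>x\<close>, a multiple of \<open>gcd y n\<close>, into a
    multiple of \<open>y\<close> modulo \<open>n\<close>.\<close>
  obtain u w where "u * y + w * int n = gcd y (int n)"
    using bezout_int by blast
  with c have x: "x = c * u * y + c * w * int n"
    by (metis (no_types) distrib_left mult.assoc mult.commute)
  have "(k * x) mod int n = (k * c * u * y) mod int n" for k
  proof -
    have "k * x = k * c * u * y + (k * c * w) * int n"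
      by (simp add: x algebra_simps)
    then show ?thesis
      by simp
  qed
  then show "generate (integer_mod_group n) {x} \<subseteq> generate (integer_mod_group n) {y}"
    unfolding generate_integer_mod_group[OF assms(1)] generate_integer_mod_group[OF assms(2)]
    by blast
qed

lemma power_graph_integer_mod_group_arc_iff:
  assumes "x \<in> carrier (integer_mod_group n)" "y \<in> carrier (integer_mod_group n)"
  shows "(x, y) \<in> parcs (power_graph (integer_mod_group n)) \<longleftrightarrow>
    x \<noteq> y \<and> (gcd x (int n) dvd gcd y (int n) \<or> gcd y (int n) dvd gcd x (int n))"
  using assms
  by (auto simp: power_graph_def generate_integer_mod_group_subset_iff)

text \<open>A divisor \<open>a < n\<close> of \<open>n\<close> is itself a vertex, with
  \<open>gcd a n = a\<close>, so adjacency can be read off from the divisors directly. The strict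
  bound matters: the divisor \<open>n\<close> is represented by the vertex 0.\<close>

lemma not_simplicial_integer_mod_groupI:
  fixes a b v :: int
  assumes "n > 0"
    and a: "a dvd int n" "0 \<le> a" "a < int n"
    and b: "b dvd int n" "0 \<le> b" "b < int n"
    and va: "gcd v (int n) \<noteq> a" "gcd v (int n) dvd a \<or> a dvd gcd v (int n)"
    and vb: "gcd v (int n) \<noteq> b" "gcd v (int n) dvd b \<or> b dvd gcd v (int n)"
    and ab: "\<not> a dvd b" "\<not> b dvd a"
  shows "\<not> simplicial_vertex (power_graph (integer_mod_group n)) v"
proof
  assume v: "simplicial_vertex (power_graph (integer_mod_group n)) v"
  have carrier: "a \<in> carrier (integer_mod_group n)" "b \<in> carrier (integer_mod_group n)"
    using \<open>n > 0\<close> a(2,3) b(2,3) by (simp_all add: carrier_integer_mod_group)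
  have carrier_v: "v \<in> carrier (integer_mod_group n)"
    using v by (simp add: simplicial_vertex_def power_graph_def)
  have gcds: "gcd a (int n) = a" "gcd b (int n) = b"
    using a(1,2) b(1,2) by (simp_all add: gcd_proj1_if_dvd)
  \<comment> \<open>Equal vertices would have equal gcds with \<open>n\<close>.\<close>
  have "v \<noteq> a" "v \<noteq> b"
    using va(1) vb(1) gcds by metis+
  then have "a \<in> neighbours (power_graph (integer_mod_group n)) v"
    "b \<in> neighbours (power_graph (integer_mod_group n)) v"
    unfolding neighbours_def mem_Collect_eq
      power_graph_integer_mod_group_arc_iff[OF carrier_v carrier(1)]
      power_graph_integer_mod_group_arc_iff[OF carrier_v carrier(2)] gcds
    using va(2) vb(2) by blast+
  moreover have "a \<noteq> b"
    using ab by auto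
  ultimately have "(a, b) \<in> parcs (power_graph (integer_mod_group n))"
    using v by (simp add: simplicial_vertex_def)
  then show False
    using ab unfolding power_graph_integer_mod_group_arc_iff[OF carrier] gcds by blast
qed

text \<open>If \<open>b = a * c\<close>, cancelling \<open>a\<close> leaves
  \<open>p = c * q\<close>, so the prime \<open>q\<close> divides the prime
  \<open>p\<close>.\<close>

lemma prime_cofactors_not_dvd:
  fixes a b p q :: int
  assumes "prime p" "prime q" "p \<noteq> q" "a * p = b * q" "a \<noteq> 0"
  shows "\<not> a dvd b"
proof
  assume "a dvd b"
  then obtain c where "b = a * c" ..
  with assms have "p = c * q"
    by simp
  then show False
    using assms by (metis dvd_triv_right primes_dvd_imp_eq)
qed

lemma cofactor_bounds:
  fixes a m p :: int
  assumes "m = a * p" "m > 0" "p > 1"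
  shows "0 < a" "a < m"
proof -
  show "0 < a"
    using assms zero_less_mult_pos2[of a p] by simp
  then show "a < m"
    using assms by simp
qed

lemma not_simplicial_of_two_primes:
  fixes p q v :: int
  assumes n: "n > 0" and pq: "prime p" "prime q" "p \<noteq> q" "p dvd int n" "q dvd int n"
    and gd: "int n = gcd v (int n) * d" and iff: "p dvd d \<longleftrightarrow> q dvd d"
  shows "\<not> simplicial_vertex (power_graph (integer_mod_group n)) v"
proof -
  define g where "g = gcd v (int n)"
  have g: "int n = g * d" "g > 0"
    using gd n by (auto simp: g_def)
  have gt1: "p > 1" "q > 1"
    using pq by (auto simp: prime_gt_1_int)
  show ?thesis
  proof (cases "p dvd d")
    case True
    then obtain d1 d2 where d: "d = p * d1" "d = q * d2"
      using iff unfolding dvd_def by metis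
    \<comment> \<open>These are \<open>n/p\<close> and \<open>n/q\<close>, written as multiples of
      \<open>g\<close> to make them comparable with \<open>g\<close>.\<close>
    define a b where "a = g * d1" and "b = g * d2"
    have ap: "int n = a * p"
      using g(1) d(1) by (simp add: a_def mult_ac)
    have bq: "int n = b * q"
      using g(1) d(2) by (simp add: b_def mult_ac)
    have a: "0 < a" "a < int n" and b: "0 < b" "b < int n"
      using cofactor_bounds[OF ap] cofactor_bounds[OF bq] n gt1 by auto
    have "\<not> a dvd b" "\<not> b dvd a"
      using prime_cofactors_not_dvd[of p q a b] prime_cofactors_not_dvd[of q p b a] pq(1-3) a b ap bq
      by auto
    moreover have "a dvd int n" "b dvd int n"
      by (simp add: ap, simp add: bq)
    moreover have ga: "g dvd a" and gb: "g dvd b"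
      by (simp_all add: a_def b_def)
    \<comment> \<open>Here \<open>g\<close> differs from \<open>a\<close> and \<open>b\<close>: it
      divides both, while neither of them divides the other.\<close>
    ultimately show ?thesis
      using n a b by (intro not_simplicial_integer_mod_groupI[of n a b]) (auto simp flip: g_def)
  next
    case False
    \<comment> \<open>Both primes divide \<open>n = g * d\<close> but not \<open>d\<close>.\<close>
    then have "p dvd g" "q dvd g"
      using iff pq g(1) by (auto simp: prime_dvd_mult_iff)
    then obtain a b where ap: "g = a * p" and bq: "g = b * q"
      by (metis dvdE mult.commute)
    have a: "0 < a" "a < g" and b: "0 < b" "b < g"
      using cofactor_bounds[OF ap] cofactor_bounds[OF bq] g(2) gt1 by auto
    have "\<not> a dvd b" "\<not> b dvd a"
      using prime_cofactors_not_dvd[of p q a b] prime_cofactors_not_dvd[of q p b a] pq(1-3) a b ap bq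
      by auto
    moreover have "g \<le> int n"
      using n by (simp add: g_def gcd_le2_int)
    moreover have ag: "a dvd g" and bg: "b dvd g"
      by (simp add: ap, simp add: bq)
    moreover have "a dvd int n" "b dvd int n"
      unfolding g(1) using ag bg by simp_all
    \<comment> \<open>The bounds \<open>a < g\<close> and \<open>b < g\<close> give distinctness
      from \<open>g\<close> and, with \<open>g \<le> n\<close>, the bound by
      \<open>n\<close>.\<close>
    ultimately show ?thesis
      using n a b by (intro not_simplicial_integer_mod_groupI[of n a b]) (simp_all flip: g_def)
  qed
qed

theorem theorem6:
  fixes n k :: nat and p \<alpha> :: "nat \<Rightarrow> nat"
  assumes "n = (\<Prod>i = 1..k. p i ^ \<alpha> i)"
    and "\<And>i. i \<in> {1..k} \<Longrightarrow> prime (p i)"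
    and "inj_on p {1..k}"
    and "\<And>i. i \<in> {1..k} \<Longrightarrow> \<alpha> i \<ge> 1"
    and "k \<ge> 3"
  shows "\<not> (\<exists>v. simplicial_vertex (power_graph (integer_mod_group n)) v)"
proof
  assume "\<exists>v. simplicial_vertex (power_graph (integer_mod_group n)) v"
  then obtain v where v: "simplicial_vertex (power_graph (integer_mod_group n)) v" ..
  have n: "n > 0"
    using assms(1,2) by (auto intro!: prod_pos simp: prime_gt_0_nat)
  have dvd: "p i dvd n" if "i \<in> {1..k}" for i
  proof -
    have "p i dvd p i ^ \<alpha> i"
      using assms(4)[OF that] by (simp add: dvd_power)
    also have "\<dots> dvd n"
      unfolding assms(1) using that by (intro dvd_prodI) auto
    finally show ?thesis .
  qed
  obtain d where d: "int n = gcd v (int n) * d"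
    by (metis dvdE gcd_dvd2)
  \<comment> \<open>Two primes that agree on dividing \<open>d\<close> would contradict the
    simpliciality of \<open>v\<close>.\<close>
  have differ: "(int (p i) dvd d) \<noteq> (int (p j) dvd d)"
    if "i \<in> {1..k}" "j \<in> {1..k}" "i \<noteq> j" for i j
  proof -
    have "int (p i) \<noteq> int (p j)"
      using inj_onD[OF assms(3)] that by auto
    then show ?thesis
      using not_simplicial_of_two_primes[OF n _ _ _ _ _ d, of "int (p i)" "int (p j)"]
        v that assms(2) dvd
      by auto
  qed
  show False
    \<comment> \<open>Pigeonhole: three truth values cannot be pairwise different.\<close>
    using differ[of 1 2] differ[of 2 3] differ[of 1 3] \<open>k \<ge> 3\<close> by auto
qed

end
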